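(* Let $X$ be a discrete topological space and let $Y$ be a $T$-locally compact topological space. Then $X \times Y$, with the product topology, is $T$-locally compact.
   Context: A topological space $X$ is called $T$-locally compact at $x \in X$ if for every open set $U$ containing $x$ there exists an open subset $V$ of $X$ containing $x$ such that the boundary $\partial V$ is compact and $V \subseteq U$. The space $X$ is called $T$-locally compact if it is $T$-locally compact at each of its points. Compactness does not include the Hausdorff condition. *)

theory Defs
  imports "HOL-Analysis.Analysis"
begin

definition T_locally_compact_at :: "'a topology \<Rightarrow> 'a \<Rightarrow> bool" where
  "T_locally_compact_at X x \<longleftrightarrow>
     (\<forall>U. openin X U \<and> x \<in> U \<longrightarrow>
        (\<exists>V. openin X V \<and> x \<in> V \<and> compactin X (X frontier_of V) \<and> V \<subseteq> U))"

definition T_locally_compact_space :: "'a topology \<Rightarrow> bool" where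
  "T_locally_compact_space X \<longleftrightarrow> (\<forall>x \<in> topspace X. T_locally_compact_at X x)"

end

theory Submission imports Defs
begin

text \<open>
  Fix \<open>(x, y)\<close> in an open set \<open>U\<close> of the product. Since the point \<open>x\<close> is isolated, \<open>U\<close> contains
  a slice \<open>{x} \<times> W\<close> with \<open>W\<close> an open neighbourhood of \<open>y\<close>, and the hypothesis on \<open>Y\<close> shrinks
  \<open>W\<close> to an open \<open>V\<close> with compact boundary. As \<open>{x}\<close> is also closed, it has no boundary of its
  own, so the boundary of the slice \<open>{x} \<times> V\<close> is just \<open>{x} \<times> \<partial>V\<close>
  (\<open>frontier_of_Times_clopen\<close>), a product of two compact sets.
\<close>

text \<open>
  Closure and interior both commute with products, and both fix a clopen set; subtracting one from
  the other therefore leaves the first factor untouched.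
\<close>

lemma frontier_of_Times_clopen:
  assumes "closedin X C" "openin X C"
  shows "prod_topology X Y frontier_of (C \<times> T) = C \<times> (Y frontier_of T)"
  using assms
  by (auto simp: frontier_of_def closure_of_Times interior_of_Times
      closure_of_closedin interior_of_openin)

theorem lemma9:
  fixes X :: "'a topology" and Y :: "'b topology"
  assumes "X = discrete_topology (topspace X)"
    and "T_locally_compact_space Y"
  shows "T_locally_compact_space (prod_topology X Y)"
  unfolding T_locally_compact_space_def T_locally_compact_at_def
proof (intro ballI allI impI, elim conjE)
  fix p U
  assume p: "p \<in> topspace (prod_topology X Y)"
    and U: "openin (prod_topology X Y) U" "p \<in> U"
  obtain x y where xy: "p = (x, y)" "x \<in> topspace X" "y \<in> topspace Y"
    using p by auto
  have clopen: "openin X {x}" "closedin X {x}"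
    using xy(2) by (subst assms(1), simp)+
  obtain A W where "openin Y W" "x \<in> A" "y \<in> W" "A \<times> W \<subseteq> U"
    using U xy(1) by (metis openin_prod_topology_alt)
  moreover from this obtain V
    where V: "openin Y V" "y \<in> V" "compactin Y (Y frontier_of V)" "V \<subseteq> W"
    using assms(2) xy(3) unfolding T_locally_compact_space_def T_locally_compact_at_def by metis
  ultimately have "{x} \<times> V \<subseteq> U"
    by auto
  moreover have "openin (prod_topology X Y) ({x} \<times> V)"
    using clopen(1) V(1) by (simp add: openin_prod_Times_iff)
  moreover have "compactin (prod_topology X Y) (prod_topology X Y frontier_of ({x} \<times> V))"
    using clopen V(3) xy(2) by (simp add: frontier_of_Times_clopen compactin_Times)
  ultimately show "\<exists>V. openin (prod_topology X Y) V \<and> p \<in> V \<and>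
      compactin (prod_topology X Y) (prod_topology X Y frontier_of V) \<and> V \<subseteq> U"
    using xy(1) V(2) by blast
qed

end
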